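(* Let $H_1,H_2:\mathcal{L}_{2e}^n\to\mathcal{L}_{2e}^n$ be causal, $\mathcal{L}_2$-stable operators with a well-posed negative feedback interconnection $y=H_1e$, $e=u-H_2y$. Assume there exist real symmetric $2\times2$ positive-negative multipliers $\Pi_1$ and $\Pi_2$ such that $\mathrm{SG}(H_i)\subset\mathcal{S}(\Pi_i)$ for $i\in\{1,2\}$. If $$\mathrm{d}\big(\mathcal{S}^{-1}(\Pi_1),\,-\mathcal{S}(\Pi_2)\big)>0,$$ then the feedback interconnection is $\mathcal{L}_2$-stable.
   Context: $\mathcal{L}_2^n$ is the space of square-integrable signals $u:\mathbb{R}_{\ge 0}\to\mathbb{R}^n$ with inner product $\langle u,y\rangle=\int_0^\infty u(t)^\top y(t)\,dt$ and norm $\|u\|^2=\langle u,u\rangle$. $\mathcal{P}_T$ denotes truncation to $[0,T]$ (signal set to zero after $T$), and $\mathcal{L}_{2e}^n$ is the space of signals $u$ with $\mathcal{P}_Tu\in\mathcal{L}_2^n$ for all $T\ge0$. $H$ is causal if $\mathcal{P}_T(Hu)=\mathcal{P}_T(H(\mathcal{P}_Tu))$ for all $T\ge0$ and all $u$. $H$ is $\mathcal{L}_2$-stable if it maps $\mathcal{L}_2^n$ to itself with finite gain: $\|Hu\|\le\gamma\|u\|$ for all $u\in\mathcal{L}_2^n$, for some $\gamma<\infty$. Well-posedness of the interconnection: for each $u\in\mathcal{L}_{2e}^n$ there exist unique $e,y\in\mathcal{L}_{2e}^n$ with $y=H_1e$, $e=u-H_2y$, and they depend causally on $u$. The interconnection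 is $\mathcal{L}_2$-stable if the resulting closed-loop map $u\mapsto y$ is $\mathcal{L}_2$-stable (maps $\mathcal{L}_2^n$ to $\mathcal{L}_2^n$ with finite gain). For $u,y\in\mathcal{L}_2^n$, $u\ne0$, let $\rho(u,y)=\|y\|/\|u\|$ and $\theta(u,y)=\arccos\!\big(\langle u,y\rangle/(\|u\|\|y\|)\big)$, with $\theta(u,y)=0$ if $y=0$. The soft scaled graph is $\mathrm{SG}(H)=\{\rho(u,y)e^{\pm \mathrm{j}\theta(u,y)}: u\in\mathcal{L}_2^n\setminus\{0\},\ y=Hu\}$. For $\Pi=\begin{bmatrix}a&b\\ b&c\end{bmatrix}$ real, $\mathcal{S}(\Pi)=\{z\in\mathbb{C}: a|z|^2+2b\,\mathrm{Re}\{z\}+c\ge0\}$. $\Pi$ is positive-negative if there is $\varepsilon>0$ with $c\ge\varepsilon$ and $a\le-\varepsilon$. $\mathcal{S}^{-1}(\Pi)=\{z^{-1}: z\in\mathcal{S}(\Pi)\setminus\{0\}\}$, where the point $z=0$, if in $\mathcal{S}(\Pi)$, is mapped to $\infty$; and $-\mathcal{S}(\Pi)=\{-z:z\in\mathcal{S}(\Pi)\}$. For nonempty sets $\mathcal{A},\mathcal{B}$, $\mathrm{d}(\mathcal{A},\mathcal{B})=\inf_{a\in\mathcal{A},\,b\in\mathcal{B}}|a-b|$, the infimum being over finite points, with the convention that $\mathrm{d}(\mathcal{A},\mathcal{B})=0$ if both sets contain $\infty$. *)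

theory Defs
  imports "HOL-Analysis.Analysis"
begin

abbreviation time_measure :: "real measure" where
  "time_measure \<equiv> lebesgue_on {0..}"

definition square_integrable :: "(real \<Rightarrow> real ^ 'n) \<Rightarrow> bool" where
  "square_integrable f \<longleftrightarrow>
     f \<in> borel_measurable time_measure \<and> integrable time_measure (\<lambda>t. (norm (f t))\<^sup>2)"

definition truncate_fun :: "real \<Rightarrow> (real \<Rightarrow> real ^ 'n) \<Rightarrow> real \<Rightarrow> real ^ 'n" where
  "truncate_fun T f = (\<lambda>t. if t \<le> T then f t else 0)"

definition extended_square_integrable :: "(real \<Rightarrow> real ^ 'n) \<Rightarrow> bool" where
  "extended_square_integrable f \<longleftrightarrow> (\<forall>T\<ge>0. square_integrable (truncate_fun T f))"

definition l2e_rel :: "(real \<Rightarrow> real ^ 'n) \<Rightarrow> (real \<Rightarrow> real ^ 'n) \<Rightarrow> bool" where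
  "l2e_rel f g \<longleftrightarrow> extended_square_integrable f \<and> extended_square_integrable g \<and>
     (AE t in time_measure. f t = g t)"

lemma truncate_fun_measurable:
  assumes "f \<in> borel_measurable time_measure"
  shows "truncate_fun T f \<in> borel_measurable time_measure"
proof -
  have "truncate_fun T f = (\<lambda>t. indicator {..T} t *\<^sub>R f t)"
    by (auto simp: truncate_fun_def indicator_def)
  moreover have "(indicator {..T} :: real \<Rightarrow> real) \<in> borel_measurable time_measure"
    by (rule measurable_restrict_space1) (auto intro!: borel_measurable_indicator)
  ultimately show ?thesis using assms by simp
qed

lemma square_integrable_truncate:
  assumes "square_integrable f"
  shows "square_integrable (truncate_fun T f)"
  unfolding square_integrable_def
proof
  show m: "truncate_fun T f \<in> borel_measurable time_measure"
    using assms by (auto simp: square_integrable_def intro: truncate_fun_measurable)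
  show "integrable time_measure (\<lambda>t. (norm (truncate_fun T f t))\<^sup>2)"
    by (rule Bochner_Integration.integrable_bound[where f = "\<lambda>t. (norm (f t))\<^sup>2"])
       (use assms m in \<open>auto simp: square_integrable_def truncate_fun_def\<close>)
qed

lemma square_integrable_add:
  assumes "square_integrable f" "square_integrable g"
  shows "square_integrable (\<lambda>t. f t + g t)"
  unfolding square_integrable_def
proof
  show m: "(\<lambda>t. f t + g t) \<in> borel_measurable time_measure"
    using assms by (auto simp: square_integrable_def)
  have bound: "(norm (x + y))\<^sup>2 \<le> 2 * ((norm x)\<^sup>2 + (norm y)\<^sup>2)" for x y :: "real ^ 'n"
  proof -
    have "(norm (x + y))\<^sup>2 \<le> (norm x + norm y)\<^sup>2"
      by (rule power_mono[OF norm_triangle_ineq]) simp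
    also have "\<dots> \<le> 2 * ((norm x)\<^sup>2 + (norm y)\<^sup>2)"
      using sum_squares_bound[of "norm x" "norm y"] by (simp add: power2_sum)
    finally show ?thesis .
  qed
  show "integrable time_measure (\<lambda>t. (norm (f t + g t))\<^sup>2)"
    by (rule Bochner_Integration.integrable_bound
          [where f = "\<lambda>t. 2 * ((norm (f t))\<^sup>2 + (norm (g t))\<^sup>2)"])
       (use assms m bound in \<open>auto simp: square_integrable_def\<close>)
qed

lemma square_integrable_uminus:
  "square_integrable f \<Longrightarrow> square_integrable (\<lambda>t. - f t)"
  by (auto simp: square_integrable_def)

lemma square_integrable_zero: "square_integrable (\<lambda>_. 0)"
  by (simp add: square_integrable_def)

lemma extended_square_integrable_truncate:
  assumes "extended_square_integrable f"
  shows "extended_square_integrable (truncate_fun T f)"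
proof -
  have "truncate_fun S (truncate_fun T f) = truncate_fun T (truncate_fun S f)" for S
    by (auto simp: truncate_fun_def)
  then show ?thesis
    using assms by (auto simp: extended_square_integrable_def intro: square_integrable_truncate)
qed

lemma extended_square_integrable_zero: "extended_square_integrable (\<lambda>_. 0)"
  by (simp add: extended_square_integrable_def truncate_fun_def square_integrable_zero)

lemma extended_square_integrable_add:
  assumes "extended_square_integrable f" "extended_square_integrable g"
  shows "extended_square_integrable (\<lambda>t. f t + g t)"
proof -
  have "truncate_fun T (\<lambda>t. f t + g t) = (\<lambda>t. truncate_fun T f t + truncate_fun T g t)" for T
    by (auto simp: truncate_fun_def)
  then show ?thesis
    using assms by (auto simp: extended_square_integrable_def intro: square_integrable_add)
qed

lemma extended_square_integrable_uminus:
  assumes "extended_square_integrable f"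
  shows "extended_square_integrable (\<lambda>t. - f t)"
proof -
  have "truncate_fun T (\<lambda>t. - f t) = (\<lambda>t. - truncate_fun T f t)" for T
    by (auto simp: truncate_fun_def)
  then show ?thesis
    using assms by (auto simp: extended_square_integrable_def intro: square_integrable_uminus)
qed

lemma extended_square_integrable_diff:
  assumes "extended_square_integrable f" "extended_square_integrable g"
  shows "extended_square_integrable (\<lambda>t. f t - g t)"
  using extended_square_integrable_add[OF assms(1) extended_square_integrable_uminus[OF assms(2)]]
  by simp

lemma part_equivp_l2e_rel: "part_equivp l2e_rel"
proof (rule part_equivpI)
  show "\<exists>f. l2e_rel f f"
    by (rule exI[of _ "\<lambda>_. 0"]) (simp add: l2e_rel_def extended_square_integrable_zero)
  show "symp l2e_rel"
    by (auto simp: symp_def l2e_rel_def elim!: eventually_mono)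
  show "transp l2e_rel"
    by (auto simp: transp_def l2e_rel_def)
qed

text \<open>
  The extended space of signals on the half-line, with signals that agree almost everywhere
  identified. Values of representatives at negative times are irrelevant.
\<close>

quotient_type 'n l2e = "real \<Rightarrow> real ^ ('n::finite)" / partial: l2e_rel
  by (rule part_equivp_l2e_rel)

instantiation l2e :: (finite) ab_group_add
begin

lift_definition zero_l2e :: "'a l2e" is "\<lambda>_. 0"
  by (simp add: l2e_rel_def extended_square_integrable_zero)

lift_definition plus_l2e :: "'a l2e \<Rightarrow> 'a l2e \<Rightarrow> 'a l2e" is "\<lambda>f g t. f t + g t"
  by (auto simp: l2e_rel_def extended_square_integrable_add)

lift_definition uminus_l2e :: "'a l2e \<Rightarrow> 'a l2e" is "\<lambda>f t. - f t"
  by (auto simp: l2e_rel_def extended_square_integrable_uminus elim!: eventually_mono)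

lift_definition minus_l2e :: "'a l2e \<Rightarrow> 'a l2e \<Rightarrow> 'a l2e" is "\<lambda>f g t. f t - g t"
  by (auto simp: l2e_rel_def extended_square_integrable_diff)

instance
  by standard
     (transfer, auto simp: l2e_rel_def algebra_simps
        intro!: extended_square_integrable_add extended_square_integrable_uminus
          extended_square_integrable_diff extended_square_integrable_zero)+

end

lift_definition truncate :: "real \<Rightarrow> 'n::finite l2e \<Rightarrow> 'n l2e" is truncate_fun
  by (auto simp: l2e_rel_def extended_square_integrable_truncate)
     (auto simp: truncate_fun_def elim!: eventually_mono)

lemma extended_square_integrable_measurable:
  assumes "extended_square_integrable f"
  shows "f \<in> borel_measurable time_measure"
proof (rule borel_measurable_LIMSEQ_metric)
  show "truncate_fun (real i) f \<in> borel_measurable time_measure" for i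
    using assms by (auto simp: extended_square_integrable_def square_integrable_def)
  show "(\<lambda>i. truncate_fun (real i) f t) \<longlonglongrightarrow> f t" for t
  proof (rule tendsto_eventually)
    obtain N :: nat where "t \<le> real N"
      using real_arch_simple by blast
    then show "\<forall>\<^sub>F i in sequentially. truncate_fun (real i) f t = f t"
      by (auto simp: truncate_fun_def eventually_sequentially intro!: exI[of _ N])
  qed
qed

lemma square_integrable_cong_AE:
  assumes "l2e_rel f g"
  shows "square_integrable f \<longleftrightarrow> square_integrable g"
proof -
  have m: "f \<in> borel_measurable time_measure" "g \<in> borel_measurable time_measure"
    using assms by (auto simp: l2e_rel_def intro: extended_square_integrable_measurable)
  have "integrable time_measure (\<lambda>t. (norm (f t))\<^sup>2) \<longleftrightarrow>
        integrable time_measure (\<lambda>t. (norm (g t))\<^sup>2)"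
    by (rule integrable_cong_AE) (use assms m in \<open>auto simp: l2e_rel_def elim!: eventually_mono\<close>)
  with m show ?thesis
    by (simp add: square_integrable_def)
qed

lift_definition l2_signal :: "'n::finite l2e \<Rightarrow> bool" is square_integrable
  by (rule square_integrable_cong_AE)

definition L2 :: "'n::finite l2e set" where
  "L2 = {u. l2_signal u}"

text \<open>
  On arguments outside \<^term>\<open>L2\<close> the Bochner integral need not exist; the inner product and
  the norm are meaningful only on \<^term>\<open>L2\<close>.
\<close>

lift_definition l2_inner :: "'n::finite l2e \<Rightarrow> 'n l2e \<Rightarrow> real" is
  "\<lambda>f g. integral\<^sup>L time_measure (\<lambda>t. f t \<bullet> g t)"
proof -
  fix f f' g g' :: "real \<Rightarrow> real ^ 'n"
  assume *: "l2e_rel f f'" "l2e_rel g g'"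
  then have "f \<in> borel_measurable time_measure" "f' \<in> borel_measurable time_measure"
      "g \<in> borel_measurable time_measure" "g' \<in> borel_measurable time_measure"
    by (auto simp: l2e_rel_def intro: extended_square_integrable_measurable)
  moreover have "AE t in time_measure. f t \<bullet> g t = f' t \<bullet> g' t"
    using * by (auto simp: l2e_rel_def)
  ultimately show "integral\<^sup>L time_measure (\<lambda>t. f t \<bullet> g t) =
      integral\<^sup>L time_measure (\<lambda>t. f' t \<bullet> g' t)"
    by (intro integral_cong_AE) auto
qed

definition l2_norm :: "'n::finite l2e \<Rightarrow> real" where
  "l2_norm u = sqrt (l2_inner u u)"

definition causal :: "('n::finite l2e \<Rightarrow> 'n l2e) \<Rightarrow> bool" where
  "causal H \<longleftrightarrow> (\<forall>T\<ge>0. \<forall>u. truncate T (H u) = truncate T (H (truncate T u)))"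

definition L2_stable :: "('n::finite l2e \<Rightarrow> 'n l2e) \<Rightarrow> bool" where
  "L2_stable H \<longleftrightarrow> (\<exists>\<gamma>::real. \<forall>u\<in>L2. H u \<in> L2 \<and> l2_norm (H u) \<le> \<gamma> * l2_norm u)"

definition feedback_solution ::
    "('n::finite l2e \<Rightarrow> 'n l2e) \<Rightarrow> ('n l2e \<Rightarrow> 'n l2e) \<Rightarrow> 'n l2e \<Rightarrow> 'n l2e \<times> 'n l2e \<Rightarrow> bool" where
  "feedback_solution H1 H2 u = (\<lambda>(e, y). y = H1 e \<and> e = u - H2 y)"

text \<open>
  The solution \<open>(e, y)\<close> as a function of the input; only meaningful if the solution is unique.
\<close>

definition closed_loop ::
    "('n::finite l2e \<Rightarrow> 'n l2e) \<Rightarrow> ('n l2e \<Rightarrow> 'n l2e) \<Rightarrow> 'n l2e \<Rightarrow> 'n l2e \<times> 'n l2e" where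
  "closed_loop H1 H2 u = (THE p. feedback_solution H1 H2 u p)"

definition well_posed :: "('n::finite l2e \<Rightarrow> 'n l2e) \<Rightarrow> ('n l2e \<Rightarrow> 'n l2e) \<Rightarrow> bool" where
  "well_posed H1 H2 \<longleftrightarrow>
     (\<forall>u. \<exists>!p. feedback_solution H1 H2 u p) \<and>
     causal (\<lambda>u. fst (closed_loop H1 H2 u)) \<and>
     causal (\<lambda>u. snd (closed_loop H1 H2 u))"

definition feedback_L2_stable ::
    "('n::finite l2e \<Rightarrow> 'n l2e) \<Rightarrow> ('n l2e \<Rightarrow> 'n l2e) \<Rightarrow> bool" where
  "feedback_L2_stable H1 H2 \<longleftrightarrow> L2_stable (\<lambda>u. snd (closed_loop H1 H2 u))"

definition sg_gain :: "'n::finite l2e \<Rightarrow> 'n l2e \<Rightarrow> real" where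
  "sg_gain u y = l2_norm y / l2_norm u"

definition sg_phase :: "'n::finite l2e \<Rightarrow> 'n l2e \<Rightarrow> real" where
  "sg_phase u y = (if y = 0 then 0 else arccos (l2_inner u y / (l2_norm u * l2_norm y)))"

definition soft_scaled_graph :: "('n::finite l2e \<Rightarrow> 'n l2e) \<Rightarrow> complex set" where
  "soft_scaled_graph H =
     {complex_of_real (sg_gain u y) * exp (\<i> * complex_of_real (s * sg_phase u y)) | u y s.
        u \<in> L2 \<and> u \<noteq> 0 \<and> y = H u \<and> s \<in> {1, -1}}"

definition multiplier_region :: "real ^ 2 ^ 2 \<Rightarrow> complex set" where
  "multiplier_region M =
     {z. M $ 1 $ 1 * (cmod z)\<^sup>2 + 2 * M $ 1 $ 2 * Re z + M $ 2 $ 2 \<ge> 0}"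

definition positive_negative :: "real ^ 2 ^ 2 \<Rightarrow> bool" where
  "positive_negative M \<longleftrightarrow> (\<exists>\<epsilon>>0. M $ 2 $ 2 \<ge> \<epsilon> \<and> M $ 1 $ 1 \<le> - \<epsilon>)"

text \<open>
  The extended complex plane is the type \<^typ>\<open>complex option\<close>, with \<^term>\<open>None\<close> as the point
  at infinity (as in the library's Alexandroff compactification).
\<close>

definition ext_inverse :: "complex \<Rightarrow> complex option" where
  "ext_inverse z = (if z = 0 then None else Some (inverse z))"

definition inverse_multiplier_region :: "real ^ 2 ^ 2 \<Rightarrow> complex option set" where
  "inverse_multiplier_region M = ext_inverse ` multiplier_region M"

definition neg_multiplier_region :: "real ^ 2 ^ 2 \<Rightarrow> complex option set" where
  "neg_multiplier_region M = (\<lambda>z. Some (- z)) ` multiplier_region M"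

text \<open>
  The infimum ranges over pairs of finite points only; it is taken in \<^typ>\<open>ereal\<close>, so that
  it is \<^term>\<open>\<infinity> :: ereal\<close> if one of the sets has no finite point.
\<close>

definition ext_setdist :: "complex option set \<Rightarrow> complex option set \<Rightarrow> ereal" where
  "ext_setdist A B =
     (if None \<in> A \<and> None \<in> B then 0
      else (INF (a, b) \<in> {(a, b). Some a \<in> A \<and> Some b \<in> B}. ereal (cmod (a - b))))"

end

theory Submission
  imports Defs
begin

text \<open>Fix a solution \<open>y = H1 e\<close>, \<open>e = u - H2 y\<close> and a time
  \<open>T\<close>, and write e', y', v' for the truncations of \<open>e\<close>, \<open>y\<close>,
  \<open>H2 y\<close>, so that e' + v' is the truncated \<open>u\<close>. Membership of the scaled
  graph in the region of a multiplier is a quadratic inequality between input and output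
  (\<open>soft_constraint\<close>). Causality and the sign of the upper left entry carry it over to
  truncated signals (\<open>hard_constraint\<close>). It is applied to \<open>H1\<close> with input
  e' and output y', and to \<open>H2\<close> with input y' and output v'.

  If y' is nonzero, \<open>planar_representation\<close> replaces e' and v', measured relative to
  y', by complex numbers \<open>w\<close> and \<open>z\<close> for which the two inequalities say
  that \<open>inverse w\<close> lies in the first region and \<open>z\<close> in the second, while
  |w + z| ||y'|| is at most ||e' + v'||. Hence \<open>w\<close> is a point of the inverted first
  region and \<open>- z\<close> one of the negated second region. If the distance exceeds \<delta> >
  0, then |w + z| is at least \<delta>, and ||y'|| is at most 1/\<delta> times the norm of the
  truncated \<open>u\<close>. This bound is uniform in \<open>T\<close>, so monotone convergence
  (\<open>bounded_truncations\<close>) puts \<open>y\<close> in \<open>L2\<close> with gain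
  1/\<delta>.\<close>

lemma square_integrable_scaleR:
  "square_integrable f \<Longrightarrow> square_integrable (\<lambda>t. c *\<^sub>R f t)"
  by (auto simp: square_integrable_def power_mult_distrib)

lemma extended_square_integrable_scaleR:
  assumes "extended_square_integrable f"
  shows "extended_square_integrable (\<lambda>t. c *\<^sub>R f t)"
proof -
  have "truncate_fun T (\<lambda>t. c *\<^sub>R f t) = (\<lambda>t. c *\<^sub>R truncate_fun T f t)" for T
    by (auto simp: truncate_fun_def)
  then show ?thesis
    using assms by (auto simp: extended_square_integrable_def intro: square_integrable_scaleR)
qed

text \<open>Scalars are needed for orthogonal projections. No inner product class is instantiated,
  because \<open>l2e\<close> also contains signals of infinite energy; the geometry below therefore
  carries \<open>L2\<close> hypotheses.\<close>

instantiation l2e :: (finite) real_vector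
begin

lift_definition scaleR_l2e :: "real \<Rightarrow> 'a l2e \<Rightarrow> 'a l2e" is "\<lambda>c f t. c *\<^sub>R f t"
  by (auto simp: l2e_rel_def extended_square_integrable_scaleR elim!: eventually_mono)

instance
  by standard
     (transfer, auto simp: l2e_rel_def algebra_simps
        intro!: extended_square_integrable_add extended_square_integrable_scaleR)+

end

section \<open>Inner product geometry of \<open>L2\<close>\<close>

lemma L2_add: "u \<in> L2 \<Longrightarrow> v \<in> L2 \<Longrightarrow> u + v \<in> L2"
  unfolding L2_def mem_Collect_eq by transfer (rule square_integrable_add)

lemma L2_scaleR: "u \<in> L2 \<Longrightarrow> c *\<^sub>R u \<in> L2"
  unfolding L2_def mem_Collect_eq by transfer (rule square_integrable_scaleR)

lemma L2_zero [simp]: "0 \<in> L2"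
  unfolding L2_def mem_Collect_eq by transfer (rule square_integrable_zero)

lemma L2_diff: "u \<in> L2 \<Longrightarrow> v \<in> L2 \<Longrightarrow> u - v \<in> L2"
  using L2_add[of u "(-1) *\<^sub>R v"] L2_scaleR[of v "-1"] by simp

lemma square_integrable_inner:
  fixes f g :: "real \<Rightarrow> real ^ 'n"
  assumes "square_integrable f" "square_integrable g"
  shows "integrable time_measure (\<lambda>t. f t \<bullet> g t)"
proof (rule Bochner_Integration.integrable_bound
          [where f = "\<lambda>t. (norm (f t))\<^sup>2 + (norm (g t))\<^sup>2"])
  have "\<bar>x \<bullet> y\<bar> \<le> (norm x)\<^sup>2 + (norm y)\<^sup>2" for x y :: "real ^ 'n"
  proof -
    have "\<bar>x \<bullet> y\<bar> \<le> norm x * norm y"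
      by (rule Cauchy_Schwarz_ineq2)
    also have "\<dots> \<le> (norm x)\<^sup>2 + (norm y)\<^sup>2"
      using sum_squares_bound[of "norm x" "norm y"] mult_nonneg_nonneg[OF norm_ge_zero[of x] norm_ge_zero[of y]]
      by linarith
    finally show ?thesis .
  qed
  then show "AE t in time_measure. norm (f t \<bullet> g t) \<le> norm ((norm (f t))\<^sup>2 + (norm (g t))\<^sup>2)"
    by simp
qed (use assms in \<open>auto simp: square_integrable_def\<close>)

lemma l2_inner_commute: "l2_inner u v = l2_inner v u"
  by transfer (simp add: inner_commute)

lemma l2_inner_add_left:
  "u \<in> L2 \<Longrightarrow> v \<in> L2 \<Longrightarrow> w \<in> L2 \<Longrightarrow> l2_inner (u + v) w = l2_inner u w + l2_inner v w"
  unfolding L2_def mem_Collect_eq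
  by transfer (simp add: inner_add_left square_integrable_inner)

text \<open>Valid on all of \<open>l2e\<close>, since the integral of a nonintegrable function is 0
  by default. The case of scalar 0 later yields that the inner product with the zero signal
  vanishes.\<close>

lemma l2_inner_scaleR_left: "l2_inner (c *\<^sub>R u) v = c * l2_inner u v"
  by transfer simp

lemma l2_inner_add_right:
  "u \<in> L2 \<Longrightarrow> v \<in> L2 \<Longrightarrow> w \<in> L2 \<Longrightarrow> l2_inner w (u + v) = l2_inner w u + l2_inner w v"
  using l2_inner_add_left[of u v w] by (simp add: l2_inner_commute)

lemma l2_inner_scaleR_right: "l2_inner u (c *\<^sub>R v) = c * l2_inner u v"
  by (metis l2_inner_commute l2_inner_scaleR_left)

lemma l2_inner_diff_left:
  "u \<in> L2 \<Longrightarrow> v \<in> L2 \<Longrightarrow> w \<in> L2 \<Longrightarrow> l2_inner (u - v) w = l2_inner u w - l2_inner v w"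
  using l2_inner_add_left[of u "(-1) *\<^sub>R v" w] L2_scaleR[of v "-1"]
    l2_inner_scaleR_left[of "-1" v w] by simp

lemma l2_inner_diff_right:
  "u \<in> L2 \<Longrightarrow> v \<in> L2 \<Longrightarrow> w \<in> L2 \<Longrightarrow> l2_inner w (u - v) = l2_inner w u - l2_inner w v"
  using l2_inner_diff_left[of u v w] by (simp add: l2_inner_commute)

lemmas l2_inner_simps = l2_inner_add_left l2_inner_add_right l2_inner_diff_left
  l2_inner_diff_right l2_inner_scaleR_left l2_inner_scaleR_right

lemma l2_inner_self_nonneg: "l2_inner u u \<ge> 0"
  by transfer simp

lemma l2_norm_nonneg [simp]: "l2_norm u \<ge> 0"
  by (simp add: l2_norm_def l2_inner_self_nonneg)

lemma l2_norm_squared: "(l2_norm u)\<^sup>2 = l2_inner u u"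
  by (simp add: l2_norm_def l2_inner_self_nonneg)

lemma l2_inner_self_eq_0D: "u \<in> L2 \<Longrightarrow> l2_inner u u = 0 \<Longrightarrow> u = 0"
  unfolding L2_def mem_Collect_eq
proof transfer
  fix f :: "real \<Rightarrow> real ^ 'a"
  assume f: "l2e_rel f f" "square_integrable f" and "(LINT t|time_measure. f t \<bullet> f t) = 0"
  then have "AE t in time_measure. f t \<bullet> f t = 0"
    using integral_nonneg_eq_0_iff_AE[OF square_integrable_inner[of f f]] by simp
  then show "l2e_rel f (\<lambda>_. 0)"
    using f by (simp add: l2e_rel_def extended_square_integrable_zero)
qed

lemma l2_norm_pos: "u \<in> L2 \<Longrightarrow> u \<noteq> 0 \<Longrightarrow> l2_norm u > 0"
  using l2_inner_self_eq_0D[of u] l2_inner_self_nonneg[of u] by (auto simp: l2_norm_def less_le)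

lemma l2_norm_zero [simp]: "l2_norm 0 = 0"
  using l2_inner_scaleR_left[of 0 0 0] by (simp add: l2_norm_def)

lemma l2_Cauchy_Schwarz:
  assumes "u \<in> L2" "v \<in> L2"
  shows "\<bar>l2_inner u v\<bar> \<le> l2_norm u * l2_norm v"
proof (cases "v = 0")
  case True
  then show ?thesis
    using l2_inner_scaleR_right[of u 0 0] by simp
next
  case False
  define V p where "V = l2_inner v v" and "p = l2_inner u v"
  have V: "V > 0"
    using l2_norm_pos[OF assms(2) False] by (simp add: V_def l2_norm_def)
  \<comment> \<open>The vector is the component of \<open>u\<close> orthogonal to
    \<open>v\<close>.\<close>
  have "0 \<le> l2_inner (u - (p / V) *\<^sub>R v) (u - (p / V) *\<^sub>R v)"
    by (rule l2_inner_self_nonneg)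
  also have "\<dots> = l2_inner u u - p\<^sup>2 / V"
    using assms V
    by (simp add: l2_inner_simps L2_scaleR L2_diff l2_inner_commute[of v u] field_simps
        power2_eq_square flip: V_def p_def)
  finally have "p\<^sup>2 \<le> l2_inner u u * V"
    using V by (simp add: field_simps)
  then have "p\<^sup>2 \<le> (l2_norm u * l2_norm v)\<^sup>2"
    by (simp add: power_mult_distrib l2_norm_squared V_def)
  then show ?thesis
    by (metis abs_le_square_iff abs_of_nonneg l2_norm_nonneg mult_nonneg_nonneg p_def)
qed

section \<open>Truncation and the passage to infinite time\<close>

lemma truncate_in_L2: "T \<ge> 0 \<Longrightarrow> truncate T u \<in> L2"
  unfolding L2_def mem_Collect_eq
  by transfer (simp add: l2e_rel_def extended_square_integrable_def)

lemma truncate_diff: "truncate T (u - v) = truncate T u - truncate T v"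
proof transfer
  fix T :: real and f g :: "real \<Rightarrow> real ^ 'a"
  assume "l2e_rel f f" "l2e_rel g g"
  moreover have "truncate_fun T (\<lambda>t. f t - g t) = (\<lambda>t. truncate_fun T f t - truncate_fun T g t)"
    by (auto simp: truncate_fun_def)
  ultimately show "l2e_rel (truncate_fun T (\<lambda>t. f t - g t))
      (\<lambda>t. truncate_fun T f t - truncate_fun T g t)"
    by (simp add: l2e_rel_def extended_square_integrable_diff extended_square_integrable_truncate)
qed

text \<open>The integrand already vanishes after time \<open>T\<close>: truncation acts as an
  orthogonal projection.\<close>

lemma l2_inner_truncate_right: "l2_inner (truncate T u) v = l2_inner (truncate T u) (truncate T v)"
  by transfer (auto simp: truncate_fun_def intro!: Bochner_Integration.integral_cong)

lemma l2_norm_truncate_le: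
  assumes "u \<in> L2"
  shows "l2_norm (truncate T u) \<le> l2_norm u"
  using assms unfolding l2_norm_def real_sqrt_le_iff L2_def mem_Collect_eq
proof transfer
  fix T :: real and f :: "real \<Rightarrow> real ^ 'a"
  assume "square_integrable f"
  then show "(LINT t|time_measure. truncate_fun T f t \<bullet> truncate_fun T f t)
      \<le> (LINT t|time_measure. f t \<bullet> f t)"
    by (intro integral_mono square_integrable_inner square_integrable_truncate)
      (auto simp: truncate_fun_def)
qed

text \<open>Monotone convergence along integer times: the truncated energies increase and are
  bounded, and the truncated integrands increase pointwise to the full one.\<close>

lemma bounded_truncations:
  assumes "\<And>T. T \<ge> 0 \<Longrightarrow> l2_norm (truncate T u) \<le> C"
  shows "u \<in> L2" and "l2_norm u \<le> C"
proof -
  have C: "C \<ge> 0"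
    using assms[of 0] l2_norm_nonneg[of "truncate 0 u"] by linarith
  have "l2_inner (truncate T u) (truncate T u) \<le> C\<^sup>2" if "T \<ge> 0" for T
    using power_mono[OF assms[OF that] l2_norm_nonneg, of 2] by (simp add: l2_norm_squared)
  then have *: "u \<in> L2 \<and> l2_inner u u \<le> C\<^sup>2"
    unfolding L2_def mem_Collect_eq
  proof transfer
    fix f :: "real \<Rightarrow> real ^ 'a" and C
    let ?g = "\<lambda>i t. truncate_fun (real i) f t \<bullet> truncate_fun (real i) f t"
    assume f: "l2e_rel f f" and
      bnd: "\<And>T. 0 \<le> T \<Longrightarrow>
        (LINT t|time_measure. truncate_fun T f t \<bullet> truncate_fun T f t) \<le> C\<^sup>2"
    have meas: "f \<in> borel_measurable time_measure"
      using f by (auto simp: l2e_rel_def intro: extended_square_integrable_measurable)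
    have int: "integrable time_measure (?g i)" for i
      using f by (auto simp: l2e_rel_def extended_square_integrable_def
          intro!: square_integrable_inner)
    have "incseq (\<lambda>i. integral\<^sup>L time_measure (?g i))"
      by (auto simp: incseq_def truncate_fun_def intro!: integral_mono[OF int int, unfolded truncate_fun_def])
    then obtain L where L: "(\<lambda>i. integral\<^sup>L time_measure (?g i)) \<longlonglongrightarrow> L"
      using incseq_convergent[of "\<lambda>i. integral\<^sup>L time_measure (?g i)" "C\<^sup>2"]
        bnd[OF of_nat_0_le_iff] by blast
    have mono: "AE t in time_measure. mono (\<lambda>i. ?g i t)"
      by (auto simp: mono_def truncate_fun_def)
    have lim: "AE t in time_measure. (\<lambda>i. ?g i t) \<longlonglongrightarrow> f t \<bullet> f t"
    proof (rule AE_I2, rule tendsto_eventually)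
      fix t :: real
      obtain N :: nat where "t \<le> real N"
        using real_arch_simple by blast
      then show "\<forall>\<^sub>F i in sequentially. ?g i t = f t \<bullet> f t"
        by (auto simp: truncate_fun_def eventually_sequentially intro!: exI[of _ N])
    qed
    have m: "(\<lambda>t. f t \<bullet> f t) \<in> borel_measurable time_measure"
      using meas by simp
    have "integrable time_measure (\<lambda>t. f t \<bullet> f t)"
      by (rule integrable_monotone_convergence[OF int mono lim L m])
    moreover have "integral\<^sup>L time_measure (\<lambda>t. f t \<bullet> f t) = L"
      by (rule integral_monotone_convergence[OF int mono lim L m])
    moreover have "L \<le> C\<^sup>2"
      using bnd by (intro LIMSEQ_le_const2[OF L]) auto
    ultimately show "square_integrable f \<and> (LINT t|time_measure. f t \<bullet> f t) \<le> C\<^sup>2"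
      using meas by (simp add: square_integrable_def power2_norm_eq_inner)
  qed
  then show "u \<in> L2" by simp
  show "l2_norm u \<le> C"
    using * C by (simp add: l2_norm_def real_le_lsqrt)
qed

section \<open>Quadratic constraints satisfied by the operators\<close>

lemma L2_stable_zero:
  assumes "L2_stable H"
  shows "H 0 = 0"
proof -
  have "H 0 \<in> L2" "l2_norm (H 0) \<le> 0"
    using assms unfolding L2_stable_def by (auto dest!: bspec[OF _ L2_zero])
  then show ?thesis
    using l2_norm_pos[of "H 0"] by fastforce
qed

lemma causalD: "causal H \<Longrightarrow> T \<ge> 0 \<Longrightarrow> truncate T (H (truncate T u)) = truncate T (H u)"
  unfolding causal_def by metis

text \<open>This is the inequality defining the region at a point \<open>z\<close> of the scaled
  graph, multiplied by the squared norm of \<open>u\<close>: |z| is the gain, and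
  \<open>Re z\<close> is the inner product of \<open>u\<close> and \<open>H u\<close> divided by
  that squared norm.\<close>

lemma soft_constraint:
  assumes "soft_scaled_graph H \<subseteq> multiplier_region M" "u \<in> L2" "u \<noteq> 0" "H u \<in> L2"
  shows "M $ 1 $ 1 * l2_inner (H u) (H u) + 2 * M $ 1 $ 2 * l2_inner u (H u)
    + M $ 2 $ 2 * l2_inner u u \<ge> 0"
proof -
  define y where "y = H u"
  \<comment> \<open>Either sign of the phase would do, as the region depends only on |z| and
    \<open>Re z\<close>. The factor 1 matches the form of the set comprehension.\<close>
  define z where "z = complex_of_real (sg_gain u y) * exp (\<i> * complex_of_real (1 * sg_phase u y))"
  have "z \<in> soft_scaled_graph H"
    using assms(2,3) unfolding soft_scaled_graph_def z_def y_def by blast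
  then have z: "M $ 1 $ 1 * (cmod z)\<^sup>2 + 2 * M $ 1 $ 2 * Re z + M $ 2 $ 2 \<ge> 0"
    using assms(1) by (auto simp: multiplier_region_def)
  have u: "l2_norm u > 0"
    using l2_norm_pos assms by blast
  have cmod: "cmod z = l2_norm y / l2_norm u"
    using u by (simp add: z_def norm_mult norm_divide sg_gain_def)
  have "l2_inner u y = l2_norm u * l2_norm y * cos (sg_phase u y)"
  proof (cases "y = 0")
    case True
    then show ?thesis
      using l2_inner_scaleR_right[of u 0 0] by simp
  next
    case False
    then have y: "l2_norm y > 0"
      using l2_norm_pos assms by (simp add: y_def)
    \<comment> \<open>Cauchy-Schwarz keeps the argument in the range where \<open>cos\<close>
      inverts \<open>arccos\<close>.\<close>
    have "\<bar>l2_inner u y / (l2_norm u * l2_norm y)\<bar> \<le> 1"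
      using l2_Cauchy_Schwarz[of u y] assms u y by (simp add: y_def divide_le_eq)
    then show ?thesis
      using False u y by (simp add: sg_phase_def cos_arccos_abs)
  qed
  moreover have "Re z = l2_norm y / l2_norm u * cos (sg_phase u y)"
    by (simp add: z_def sg_gain_def Re_exp)
  ultimately have Re: "Re z = l2_inner u y / (l2_norm u)\<^sup>2"
    using u by (simp add: field_simps power2_eq_square)
  have "0 \<le> (M $ 1 $ 1 * (cmod z)\<^sup>2 + 2 * M $ 1 $ 2 * Re z + M $ 2 $ 2) * (l2_norm u)\<^sup>2"
    using z by simp
  also have "\<dots> = M $ 1 $ 1 * (l2_norm y)\<^sup>2 + 2 * M $ 1 $ 2 * l2_inner u y
    + M $ 2 $ 2 * (l2_norm u)\<^sup>2"
    using u unfolding cmod Re by (simp add: distrib_right power_divide)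
  finally show ?thesis
    by (simp add: l2_norm_squared y_def)
qed

text \<open>
  The truncated response has the same inner product with the truncated input as the response
  to the truncated input, but at most its norm; the sign of \<open>M\<^sub>1\<^sub>1\<close> makes this harmless.
\<close>

lemma hard_constraint:
  assumes "causal H" "L2_stable H" "positive_negative M"
    and "soft_scaled_graph H \<subseteq> multiplier_region M"
    and T: "T \<ge> 0" and nz: "truncate T u \<noteq> 0"
  shows "M $ 1 $ 1 * l2_inner (truncate T (H u)) (truncate T (H u))
    + 2 * M $ 1 $ 2 * l2_inner (truncate T u) (truncate T (H u))
    + M $ 2 $ 2 * l2_inner (truncate T u) (truncate T u) \<ge> 0"
proof -
  define y where "y = H (truncate T u)"
  have y: "y \<in> L2"
    using assms(2) truncate_in_L2[OF T] by (auto simp: L2_stable_def y_def)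
  have tr: "truncate T y = truncate T (H u)"
    unfolding y_def by (rule causalD[OF assms(1) T])
  have "l2_norm (truncate T y) \<le> l2_norm y"
    by (rule l2_norm_truncate_le[OF y])
  then have "l2_inner (truncate T y) (truncate T y) \<le> l2_inner y y"
    by (simp add: l2_norm_def)
  moreover have "M $ 1 $ 1 \<le> 0"
    using assms(3) by (auto simp: positive_negative_def)
  ultimately have "M $ 1 $ 1 * l2_inner y y \<le> M $ 1 $ 1 * l2_inner (truncate T y) (truncate T y)"
    by (rule mult_left_mono_neg)
  moreover have "M $ 1 $ 1 * l2_inner y y + 2 * M $ 1 $ 2 * l2_inner (truncate T u) y
    + M $ 2 $ 2 * l2_inner (truncate T u) (truncate T u) \<ge> 0"
    using soft_constraint[OF assms(4) truncate_in_L2[OF T] nz] y by (simp add: y_def)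
  ultimately show ?thesis
    using l2_inner_truncate_right[of T u y] by (simp add: tr)
qed

section \<open>Reduction to the complex plane\<close>

text \<open>
  Splitting \<open>e\<close> and \<open>v\<close> along \<open>y\<close> and its orthogonal complement represents them, relative to
  \<open>y\<close>, by points of the complex plane. The orthogonal parts are placed on opposite sides of the
  real axis, since the worst case is the one in which they cancel.
\<close>

lemma planar_representation:
  assumes "e \<in> L2" "v \<in> L2" "y \<in> L2" "y \<noteq> 0"
  obtains w z where "(cmod w)\<^sup>2 = l2_inner e e / l2_inner y y" "Re w = l2_inner e y / l2_inner y y"
    and "(cmod z)\<^sup>2 = l2_inner v v / l2_inner y y" "Re z = l2_inner v y / l2_inner y y"
    and "cmod (w + z) * l2_norm y \<le> l2_norm (e + v)"
proof -
  define A p q where "A = l2_inner y y" and "p = l2_inner e y" and "q = l2_inner v y"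
  define r s where "r = e - (p / A) *\<^sub>R y" and "s = v - (q / A) *\<^sub>R y"
  have y: "l2_norm y > 0"
    using assms l2_norm_pos by blast
  then have A: "A > 0"
    by (simp add: A_def l2_norm_def)
  have L2: "r \<in> L2" "s \<in> L2"
    using assms by (auto simp: r_def s_def intro: L2_diff L2_scaleR)
  have orth: "l2_inner r y = 0" "l2_inner s y = 0"
    using assms A by (simp_all add: r_def s_def l2_inner_simps L2_scaleR flip: A_def p_def q_def)
  have e: "e = (p / A) *\<^sub>R y + r" and v: "v = (q / A) *\<^sub>R y + s"
    by (simp_all add: r_def s_def)
  \<comment> \<open>Pythagoras for a multiple of \<open>y\<close> plus a vector orthogonal to
    \<open>y\<close>.\<close>
  have split: "l2_inner (c *\<^sub>R y + x) (c *\<^sub>R y + x) = c\<^sup>2 * A + l2_inner x x"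
    if "x \<in> L2" "l2_inner x y = 0" for c x
    using that assms
    by (simp add: l2_inner_simps L2_scaleR L2_add l2_inner_commute[of y x] A_def power2_eq_square)
  define w where "w = Complex (p / A) (l2_norm r / l2_norm y)"
  define z where "z = Complex (q / A) (- (l2_norm s / l2_norm y))"
  have ny: "(l2_norm y)\<^sup>2 = A"
    by (simp add: A_def l2_norm_squared)
  have ee: "l2_inner e e = (p / A)\<^sup>2 * A + (l2_norm r)\<^sup>2"
    using split[OF L2(1) orth(1), of "p / A"] e by (simp add: l2_norm_squared)
  have vv: "l2_inner v v = (q / A)\<^sup>2 * A + (l2_norm s)\<^sup>2"
    using split[OF L2(2) orth(2), of "q / A"] v by (simp add: l2_norm_squared)
  have "(cmod (w + z) * l2_norm y)\<^sup>2
      = ((p / A + q / A)\<^sup>2 + ((l2_norm r - l2_norm s) / l2_norm y)\<^sup>2) * (l2_norm y)\<^sup>2"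
    by (simp add: w_def z_def cmod_power2 power_mult_distrib diff_divide_distrib)
  also have "\<dots> = (p / A + q / A)\<^sup>2 * A + (l2_norm r - l2_norm s)\<^sup>2"
    using y by (simp add: distrib_right power_divide flip: ny)
  \<comment> \<open>The reverse triangle inequality: by Cauchy-Schwarz the inner product of
    \<open>r\<close> and \<open>s\<close> is at least minus the product of their norms.\<close>
  also have "(l2_norm r - l2_norm s)\<^sup>2 \<le> l2_inner (r + s) (r + s)"
    using l2_Cauchy_Schwarz[OF L2] L2
    by (simp add: l2_inner_simps L2_add l2_inner_commute[of s r] power2_diff l2_norm_squared)
  also have "(p / A + q / A)\<^sup>2 * A + l2_inner (r + s) (r + s)
      = l2_inner ((p / A + q / A) *\<^sub>R y + (r + s)) ((p / A + q / A) *\<^sub>R y + (r + s))"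
    using split[of "r + s" "p / A + q / A"] L2 assms orth
    by (simp add: L2_add l2_inner_add_left)
  also have "(p / A + q / A) *\<^sub>R y + (r + s) = e + v"
    by (subst e, subst v) (simp add: algebra_simps)
  finally have "(cmod (w + z) * l2_norm y)\<^sup>2 \<le> (l2_norm (e + v))\<^sup>2"
    by (simp add: l2_norm_squared)
  then have le: "cmod (w + z) * l2_norm y \<le> l2_norm (e + v)"
    by (rule power2_le_imp_le) simp
  have "(cmod w)\<^sup>2 = l2_inner e e / A" "(cmod z)\<^sup>2 = l2_inner v v / A"
    using A by (simp_all add: w_def z_def cmod_power2 ee vv ny power_divide add_divide_distrib)
  then show thesis
    using that[of w z] le by (simp add: w_def z_def A_def p_def q_def)
qed

section \<open>The closed loop estimate\<close>

theorem corollary2: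
  fixes H1 H2 :: "'n::finite l2e \<Rightarrow> 'n l2e"
    and \<Pi>1 \<Pi>2 :: "real ^ 2 ^ 2"
  assumes "causal H1" and "causal H2"
    and "L2_stable H1" and "L2_stable H2"
    and "well_posed H1 H2"
    and "transpose \<Pi>1 = \<Pi>1" and "transpose \<Pi>2 = \<Pi>2"
    and "positive_negative \<Pi>1" and "positive_negative \<Pi>2"
    and "soft_scaled_graph H1 \<subseteq> multiplier_region \<Pi>1"
    and "soft_scaled_graph H2 \<subseteq> multiplier_region \<Pi>2"
    and "ext_setdist (inverse_multiplier_region \<Pi>1) (neg_multiplier_region \<Pi>2) > 0"
  shows "feedback_L2_stable H1 H2"
proof -
  \<comment> \<open>The negated region has no point at infinity, so the distance is the infimum over
    finite points.\<close>
  have "None \<notin> neg_multiplier_region \<Pi>2"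
    by (auto simp: neg_multiplier_region_def)
  then have "0 < (INF (a, b) \<in> {(a, b). Some a \<in> inverse_multiplier_region \<Pi>1 \<and>
      Some b \<in> neg_multiplier_region \<Pi>2}. ereal (cmod (a - b)))"
    using assms(12) by (simp add: ext_setdist_def)
  \<comment> \<open>A real number strictly below the infimum is chosen, because the infimum itself
    may be infinite in \<open>ereal\<close>.\<close>
  then obtain \<delta> where \<delta>: "0 < ereal \<delta>" "ereal \<delta> < (INF (a, b) \<in> {(a, b).
      Some a \<in> inverse_multiplier_region \<Pi>1 \<and> Some b \<in> neg_multiplier_region \<Pi>2}.
      ereal (cmod (a - b)))"
    using ereal_dense2 by blast
  have sep: "\<delta> \<le> cmod (w + z)"
    if "w \<noteq> 0" "inverse w \<in> multiplier_region \<Pi>1" "z \<in> multiplier_region \<Pi>2" for w z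
  proof -
    have "Some w \<in> inverse_multiplier_region \<Pi>1"
      using that unfolding inverse_multiplier_region_def
      by (intro image_eqI[of _ _ "inverse w"]) (simp_all add: ext_inverse_def)
    moreover have "Some (- z) \<in> neg_multiplier_region \<Pi>2"
      using that by (auto simp: neg_multiplier_region_def)
    ultimately have "ereal \<delta> < ereal (cmod (w - (- z)))"
      by (intro less_le_trans[OF \<delta>(2)] INF_lower2[of "(w, - z)"]) auto
    then show ?thesis by simp
  qed
  have \<delta>pos: "\<delta> > 0"
    using \<delta>(1) by simp
  have key: "l2_norm (truncate T y) \<le> 1 / \<delta> * l2_norm (truncate T u)"
    if sol: "y = H1 e" "e = u - H2 y" and T: "T \<ge> 0" for u e y T
  proof (cases "truncate T y = 0")
    case True
    then show ?thesis using \<delta>pos by simp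
  next
    case False
    define e' v' y' where "e' = truncate T e" and "v' = truncate T (H2 y)" and "y' = truncate T y"
    note defs = e'_def v'_def y'_def
    have L2: "e' \<in> L2" "v' \<in> L2" "y' \<in> L2"
      using T by (simp_all add: defs truncate_in_L2)
    \<comment> \<open>Scaled graphs only see nonzero inputs, and \<open>w\<close> must be
      invertible. If e' were zero, causality and \<open>H1 0 = 0\<close> would make the truncated
      \<open>y\<close> zero.\<close>
    have e'nz: "e' \<noteq> 0"
    proof
      assume "e' = 0"
      then have "truncate T y = truncate T (H1 0)"
        using causalD[OF assms(1) T, of e] sol(1) by (simp add: e'_def)
      then show False
        using False L2_stable_zero[OF assms(3)] truncate_diff[of T 0 "0 :: 'n l2e"] by simp
    qed
    have hard1: "\<Pi>1 $ 1 $ 1 * l2_inner y' y' + 2 * \<Pi>1 $ 1 $ 2 * l2_inner e' y'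
        + \<Pi>1 $ 2 $ 2 * l2_inner e' e' \<ge> 0"
      using hard_constraint[OF assms(1,3,8,10) T, of e] e'nz sol(1) by (simp add: defs)
    have hard2: "\<Pi>2 $ 1 $ 1 * l2_inner v' v' + 2 * \<Pi>2 $ 1 $ 2 * l2_inner v' y'
        + \<Pi>2 $ 2 $ 2 * l2_inner y' y' \<ge> 0"
      using hard_constraint[OF assms(2,4,9,11) T False]
      by (simp add: defs l2_inner_commute[of "truncate T y" "truncate T (H2 y)"])
    have y'nz: "y' \<noteq> 0"
      using False by (simp add: defs)
    obtain w z where w: "(cmod w)\<^sup>2 = l2_inner e' e' / l2_inner y' y'"
        "Re w = l2_inner e' y' / l2_inner y' y'"
      and z: "(cmod z)\<^sup>2 = l2_inner v' v' / l2_inner y' y'"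
        "Re z = l2_inner v' y' / l2_inner y' y'"
      and le: "cmod (w + z) * l2_norm y' \<le> l2_norm (e' + v')"
      by (rule planar_representation[OF L2 y'nz])
    have pos: "l2_inner y' y' > 0" "l2_inner e' e' > 0"
      using l2_norm_pos[OF L2(3) y'nz] l2_norm_pos[OF L2(1) e'nz]
      by (simp_all add: l2_norm_def)
    have "w \<noteq> 0"
      using w(1) pos by auto
    \<comment> \<open>Here \<open>w\<close> stands for input over output of \<open>H1\<close>, so it
      is \<open>inverse w\<close> that belongs to the region of the first multiplier; normalising by
      e' instead of y' shows this.\<close>
    have Re_inv: "Re (inverse w) = Re w / (cmod w)\<^sup>2"
      by (simp add: cmod_power2)
    have "\<Pi>1 $ 1 $ 1 * (cmod (inverse w))\<^sup>2 + 2 * \<Pi>1 $ 1 $ 2 * Re (inverse w) + \<Pi>1 $ 2 $ 2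
        = (\<Pi>1 $ 1 $ 1 * l2_inner y' y' + 2 * \<Pi>1 $ 1 $ 2 * l2_inner e' y'
        + \<Pi>1 $ 2 $ 2 * l2_inner e' e') / l2_inner e' e'"
      using pos unfolding Re_inv by (simp add: norm_inverse power_inverse w add_divide_distrib)
    then have "inverse w \<in> multiplier_region \<Pi>1"
      using hard1 pos by (simp add: multiplier_region_def)
    moreover have "\<Pi>2 $ 1 $ 1 * (cmod z)\<^sup>2 + 2 * \<Pi>2 $ 1 $ 2 * Re z + \<Pi>2 $ 2 $ 2
        = (\<Pi>2 $ 1 $ 1 * l2_inner v' v' + 2 * \<Pi>2 $ 1 $ 2 * l2_inner v' y'
        + \<Pi>2 $ 2 $ 2 * l2_inner y' y') / l2_inner y' y'"
      using pos unfolding z by (simp add: add_divide_distrib)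
    then have "z \<in> multiplier_region \<Pi>2"
      using hard2 pos by (simp add: multiplier_region_def)
    ultimately have "\<delta> \<le> cmod (w + z)"
      using sep \<open>w \<noteq> 0\<close> by blast
    then have "\<delta> * l2_norm y' \<le> l2_norm (e' + v')"
      using le mult_right_mono[of \<delta> "cmod (w + z)" "l2_norm y'"] by simp
    moreover have "e' + v' = truncate T u"
      using sol(2) by (simp add: defs truncate_diff)
    ultimately have "\<delta> * l2_norm y' \<le> l2_norm (truncate T u)"
      by metis
    then show ?thesis
      using \<delta>pos by (simp add: y'_def pos_le_divide_eq mult.commute)
  qed
  have "snd (closed_loop H1 H2 u) \<in> L2 \<and> l2_norm (snd (closed_loop H1 H2 u)) \<le> 1 / \<delta> * l2_norm u"
    if u: "u \<in> L2" for u
  proof -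
    have "feedback_solution H1 H2 u (closed_loop H1 H2 u)"
      using assms(5) unfolding closed_loop_def well_posed_def by (blast intro: theI')
    moreover obtain e y where ey: "closed_loop H1 H2 u = (e, y)"
      by (rule prod.exhaust)
    ultimately have sol: "y = H1 e" "e = u - H2 y"
      unfolding feedback_solution_def ey split_conv by blast+
    \<comment> \<open>Bounding the truncated input by the whole input makes the right side
      independent of \<open>T\<close>, as \<open>bounded_truncations\<close> requires.\<close>
    have "l2_norm (truncate T y) \<le> 1 / \<delta> * l2_norm u" if "T \<ge> 0" for T
    proof -
      have "1 / \<delta> * l2_norm (truncate T u) \<le> 1 / \<delta> * l2_norm u"
        using \<delta>pos by (intro mult_left_mono l2_norm_truncate_le[OF u]) simp
      then show ?thesis
        using key[OF sol that] by linarith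
    qed
    then show ?thesis
      using bounded_truncations[of y "1 / \<delta> * l2_norm u"] ey by simp
  qed
  then show ?thesis
    unfolding feedback_L2_stable_def L2_stable_def by blast
qed

end
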